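(* Let $C\subseteq\mathbb{R}^m$ be a nonempty convex set (of probability vectors) and let $\ell:C\times C\to\mathbb{R}$, $(q,p)\mapsto \ell(q,p)$, be a loss function that is differentiable in $p$. Suppose: (i) (Extended convexity) there is an $L_2$-norm power function $\psi$ such that for every $q\in C$ the function $p\mapsto\ell(q,p)$ is $\mathcal{H}(\psi)$-convex; (ii) (Expectation optimality) for every (finitely supported) probability distribution $Q$ on $C$, the expected loss $p\mapsto \mathbb{E}_{\omega\sim Q}[\ell(\omega,p)]$ attains its global minimum over $C$ at $p=\mathbb{E}_{\omega\sim Q}[\omega]$. Then there exists a strictly convex (differentiable) function $\Phi$ on $C$ such that for all $q,p\in C$ $$\ell(q,p)-\ell(q,q)=d_\Phi(q,p_\Phi^* ),\qquad p_\Phi^*:=\nabla\Phi(p),$$ where $d_\Phi$ is the Fenchel-Young loss generated by $\Phi$.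
   Context: An $L_2$-norm power function is a function $\psi(\mu)=\|a_\psi\mu\|_2^{r_\psi}/r_\psi$ with $a_\psi>0$, $r_\psi>1$. For a differentiable function $F$ put $S_F(\mu,\nu)=F(\mu)-F(\nu)-\langle\nabla F(\nu),\mu-\nu\rangle$; $F$ is $\mathcal{H}(\psi)$-convex if $S_F(\mu,\nu)\ge\psi(\mu-\nu)$ for all $\mu,\nu\in\mathrm{dom}(F)$. If $C$ is not open or not full-dimensional, gradients of functions on $C$ are understood relative to the affine hull of $C$. The Legendre-Fenchel conjugate is $\Phi^*(\nu)=\sup_{\mu\in\mathrm{dom}(\Phi)}\{\langle\mu,\nu\rangle-\Phi(\mu)\}$, and the Fenchel-Young loss is $d_\Phi(\mu,\nu)=\Phi(\mu)+\Phi^*(\nu)-\langle\mu,\nu\rangle$. *)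

theory Defs
  imports "HOL-Probability.Probability"
begin

definition l2_norm_power_function :: "('a::euclidean_space \<Rightarrow> real) \<Rightarrow> bool" where
  "l2_norm_power_function \<psi> \<longleftrightarrow>
     (\<exists>a>0. \<exists>r>1. \<psi> = (\<lambda>\<mu>. norm (a *\<^sub>R \<mu>) powr r / r))"

text \<open>A function with domain \<open>C\<close> is a total function of which only the values on \<open>C\<close> matter.
  Its gradient is taken relative to the affine hull of \<open>C\<close>: among the vectors representing the
  derivative within \<open>C\<close>, it is the one parallel to the affine hull.  For a convex \<open>C\<close> it
  exists and is unique at every point of \<open>C\<close>, including relative boundary points, where \<open>f\<close> is
  differentiable (\<open>rel_gradient_ex1\<close>); for an open \<open>C\<close> it is the ordinary gradient.\<close>

definition has_rel_gradient ::
    "'a::euclidean_space set \<Rightarrow> ('a \<Rightarrow> real) \<Rightarrow> 'a \<Rightarrow> 'a \<Rightarrow> bool" where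
  "has_rel_gradient C f p g \<longleftrightarrow>
     g \<in> {u - v |u v. u \<in> affine hull C \<and> v \<in> affine hull C} \<and>
     (f has_derivative (\<lambda>h. g \<bullet> h)) (at p within C)"

definition rel_gradient :: "'a::euclidean_space set \<Rightarrow> ('a \<Rightarrow> real) \<Rightarrow> 'a \<Rightarrow> 'a" where
  "rel_gradient C f p = (THE g. has_rel_gradient C f p g)"

definition bregman_remainder ::
    "'a::euclidean_space set \<Rightarrow> ('a \<Rightarrow> real) \<Rightarrow> 'a \<Rightarrow> 'a \<Rightarrow> real" where
  "bregman_remainder C f \<mu> \<nu> = f \<mu> - f \<nu> - rel_gradient C f \<nu> \<bullet> (\<mu> - \<nu>)"

definition H_convex_on ::
    "'a::euclidean_space set \<Rightarrow> ('a \<Rightarrow> real) \<Rightarrow> ('a \<Rightarrow> real) \<Rightarrow> bool" where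
  "H_convex_on C \<psi> f \<longleftrightarrow>
     f differentiable_on C \<and> (\<forall>\<mu>\<in>C. \<forall>\<nu>\<in>C. bregman_remainder C f \<mu> \<nu> \<ge> \<psi> (\<mu> - \<nu>))"

definition strictly_convex_on :: "'a::real_vector set \<Rightarrow> ('a \<Rightarrow> real) \<Rightarrow> bool" where
  "strictly_convex_on C f \<longleftrightarrow> convex C \<and>
     (\<forall>x\<in>C. \<forall>y\<in>C. \<forall>t. x \<noteq> y \<and> 0 < t \<and> t < 1 \<longrightarrow>
        f ((1 - t) *\<^sub>R x + t *\<^sub>R y) < (1 - t) * f x + t * f y)"

text \<open>The supremum may be infinite, so conjugate and Fenchel-Young loss are extended-real-valued.\<close>

definition conjugate :: "'a::euclidean_space set \<Rightarrow> ('a \<Rightarrow> real) \<Rightarrow> 'a \<Rightarrow> ereal" where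
  "conjugate C \<Phi> \<nu> = (SUP \<mu>\<in>C. ereal (\<mu> \<bullet> \<nu> - \<Phi> \<mu>))"

definition fenchel_young_loss ::
    "'a::euclidean_space set \<Rightarrow> ('a \<Rightarrow> real) \<Rightarrow> 'a \<Rightarrow> 'a \<Rightarrow> ereal" where
  "fenchel_young_loss C \<Phi> \<mu> \<nu> = ereal (\<Phi> \<mu>) + conjugate C \<Phi> \<nu> - ereal (\<mu> \<bullet> \<nu>)"

lemma has_rel_gradient_unique:
  assumes "convex C" "p \<in> C" "has_rel_gradient C f p g" "has_rel_gradient C f p g'"
  shows "g = g'"
proof -
  let ?d = "g - g'"
  have "((\<lambda>x. f x - f x) has_derivative (\<lambda>h. g \<bullet> h - g' \<bullet> h)) (at p within C)"
    using assms(3,4) unfolding has_rel_gradient_def by (intro has_derivative_diff) auto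
  then have d0: "((\<lambda>x. 0::real) has_derivative (\<lambda>h. ?d \<bullet> h)) (at p within C)"
    by (simp add: inner_diff_left)
  have orth: "?d \<bullet> (x - p) = 0" if "x \<in> C" for x
  proof -
    let ?s = "\<lambda>t::real. p + t *\<^sub>R (x - p)"
    have im: "?s ` {0..1} \<subseteq> C"
    proof
      fix y assume "y \<in> ?s ` {0..1}"
      then obtain t where "0 \<le> t" "t \<le> 1" "y = (1 - t) *\<^sub>R p + t *\<^sub>R x"
        by (auto simp: algebra_simps)
      then show "y \<in> C" using convexD_alt[OF assms(1,2) that] by simp
    qed
    have "(?s has_derivative (\<lambda>t. t *\<^sub>R (x - p))) (at 0 within {0..1})"
      by (auto intro!: derivative_eq_intros)
    moreover have "((\<lambda>x. 0::real) has_derivative (\<lambda>h. ?d \<bullet> h)) (at (?s 0) within ?s ` {0..1})"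
      using has_derivative_subset[OF d0 im] by simp
    ultimately have "((\<lambda>t. 0::real) has_derivative (\<lambda>t. ?d \<bullet> (t *\<^sub>R (x - p)))) (at 0 within {0..1})"
      by (rule has_derivative_in_compose)
    then have "((\<lambda>t. 0::real) has_vector_derivative ?d \<bullet> (x - p)) (at 0 within {0..1})"
      by (simp add: has_vector_derivative_def)
    moreover have "((\<lambda>t. 0::real) has_vector_derivative 0) (at 0 within {0..1})"
      by simp
    ultimately show ?thesis
      by (metis vector_derivative_unique_within_closed_interval[of 0 1 0]
          atLeastAtMost_iff box_real(2) less_eq_real_def zero_less_one)
  qed
  have "C \<subseteq> {x. ?d \<bullet> x = ?d \<bullet> p}"
    using orth by (auto simp: inner_diff_right)
  then have sub: "affine hull C \<subseteq> {x. ?d \<bullet> x = ?d \<bullet> p}"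
    by (rule hull_minimal) (rule affine_hyperplane)
  have *: "?d \<bullet> (u - v) = 0" if "u \<in> affine hull C" "v \<in> affine hull C" for u v
  proof -
    have "?d \<bullet> u = ?d \<bullet> p" "?d \<bullet> v = ?d \<bullet> p"
      using sub that by blast+
    then show ?thesis by (simp add: inner_diff_right[of _ u v])
  qed
  have "?d \<bullet> g = 0" "?d \<bullet> g' = 0"
    using assms(3,4) * unfolding has_rel_gradient_def by blast+
  then have "?d \<bullet> ?d = 0"
    by (simp add: inner_diff_right)
  then show ?thesis by simp
qed

lemma rel_gradient_ex1:
  assumes "convex C" "p \<in> C" "f differentiable (at p within C)"
  shows "\<exists>!g. has_rel_gradient C f p g"
proof -
  let ?V = "{u - v |u v. u \<in> affine hull C \<and> v \<in> affine hull C}"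
  have V: "?V = span ((\<lambda>x. x - p) ` C)"
  proof -
    have e: "affine hull C = {p + v |v. v \<in> span ((\<lambda>x. x - p) ` C)}" (is "_ = {p + v |v. v \<in> ?S}")
      using affine_hull_insert_span_gen[of p C] assms(2)
      by (auto simp: image_iff Bex_def add.commute insert_absorb)
    show ?thesis
    proof
      show "?V \<subseteq> ?S" unfolding e by (auto intro: span_diff)
      show "?S \<subseteq> ?V"
      proof
        fix w assume "w \<in> ?S"
        then have "w = (p + w) - (p + 0)" "p + w \<in> affine hull C" "p + 0 \<in> affine hull C"
          unfolding e by (auto intro: span_zero)
        then show "w \<in> ?V" by blast
      qed
    qed
  qed
  obtain D where D: "(f has_derivative D) (at p within C)"
    using assms(3) by (auto simp: differentiable_def)
  then have lin: "linear D" by (rule has_derivative_linear)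
  define k where "k = (\<Sum>b\<in>Basis. D b *\<^sub>R b)"
  have Dk: "D h = k \<bullet> h" for h
  proof -
    have "D h = D (\<Sum>b\<in>Basis. (h \<bullet> b) *\<^sub>R b)" by (simp add: euclidean_representation)
    also have "\<dots> = k \<bullet> h"
      by (simp add: k_def linear_sum[OF lin] linear_cmul[OF lin] inner_sum_left inner_commute[of h] mult.commute)
    finally show ?thesis .
  qed
  obtain g z where g: "g \<in> span ((\<lambda>x. x - p) ` C)" and z: "\<And>w. w \<in> span ((\<lambda>x. x - p) ` C) \<Longrightarrow> orthogonal z w"
    and kgz: "k = g + z"
    using orthogonal_subspace_decomp_exists[of "(\<lambda>x. x - p) ` C" k] by blast
  have eq: "D (y - p) = g \<bullet> (y - p)" if "y \<in> C" for y
  proof -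
    have "y - p \<in> span ((\<lambda>x. x - p) ` C)"
      using that by (auto intro: span_base)
    then show ?thesis
      using z by (auto simp: Dk kgz inner_add_left orthogonal_def)
  qed
  have "(f has_derivative (\<lambda>h. g \<bullet> h)) (at p within C)"
    using D eq by (simp add: has_derivative_within_alt bounded_linear_inner_right)
  moreover have "g \<in> ?V"
    using g V by blast
  ultimately have "has_rel_gradient C f p g"
    by (simp add: has_rel_gradient_def)
  then show ?thesis
    using has_rel_gradient_unique[OF assms(1,2)] by blast
qed

end

theory Submission
  imports Defs
begin

text \<open>Fix \<open>z \<in> C\<close>.  If \<open>q\<close> is a convex combination of points \<open>x\<close>, \<open>y\<close>, then every point \<open>p\<close> of the
  relative interior is the mean both of a distribution on \<open>q\<close>, \<open>w\<close> and of the one that splits the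
  mass of \<open>q\<close> among \<open>x\<close>, \<open>y\<close>, for a suitable \<open>w \<in> C\<close>.  Both expected losses are stationary at \<open>p\<close>, so
  \<open>loss q p\<close> and the corresponding combination of \<open>loss x p\<close> and \<open>loss y p\<close> differ by a constant,
  first for \<open>p\<close> in the relative interior and then, by continuity, for all \<open>p \<in> C\<close>.  Hence
  \<open>q \<mapsto> loss q z - loss q p\<close> is affine on \<open>C\<close>, with some slope \<open>\<eta> p\<close>.  Set
  \<open>\<Phi> q = loss q z - loss q q\<close>; then
  \<open>\<Phi> q - \<Phi> p - \<eta> p \<bullet> (q - p) = loss q p - loss q q\<close>.  Optimality at point masses puts this
  remainder between \<open>0\<close> and \<open>(\<eta> q - \<eta> p) \<bullet> (q - p)\<close>, which is \<open>o(norm (q - p))\<close> because \<open>\<eta>\<close> is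
  continuous.  So \<open>\<eta> p\<close> is the gradient of \<open>\<Phi>\<close> at \<open>p\<close>, also on the relative boundary, where the
  gradient of \<open>loss p\<close> at \<open>p\<close> need not vanish.\<close>

section \<open>Slopes of affine functions on a convex set\<close>

lemma convex_cone_combination:
  fixes S :: "'a::real_vector set"
  assumes "convex S" "s \<in> S" "t \<in> S" "0 \<le> a" "0 \<le> b"
  obtains u where "u \<in> S" "a *\<^sub>R s + b *\<^sub>R t = (a + b) *\<^sub>R u"
proof (cases "a + b = 0")
  case True
  then have "a = 0" "b = 0" using assms by linarith+
  then show ?thesis using that[of s] assms by simp
next
  case False
  then have pos: "a + b > 0" using assms by linarith
  let ?u = "(a / (a + b)) *\<^sub>R s + (b / (a + b)) *\<^sub>R t"
  have "?u \<in> S"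
    using assms pos by (intro convexD) (auto simp: add_divide_distrib[symmetric])
  moreover have "a *\<^sub>R s + b *\<^sub>R t = (a + b) *\<^sub>R ?u"
    using pos by (simp add: scaleR_right_distrib)
  ultimately show ?thesis by (rule that)
qed

text \<open>Nonnegative multiples of points of a convex set are closed under addition, and a
  negative scalar swaps the two terms of a difference. So these differences already form a subspace
  containing \<open>S\<close>.\<close>

lemma span_convex_difference:
  fixes S :: "'a::real_vector set"
  assumes "convex S" "v \<in> span S" "S \<noteq> {}"
  obtains a b s t where "0 \<le> a" "0 \<le> b" "s \<in> S" "t \<in> S" "v = a *\<^sub>R s - b *\<^sub>R t"
proof -
  let ?K = "{a *\<^sub>R s - b *\<^sub>R t |a b s t. 0 \<le> a \<and> 0 \<le> b \<and> s \<in> S \<and> t \<in> S}"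
  have "subspace ?K"
  proof (rule subspaceI)
    obtain s where "s \<in> S" using assms by blast
    then have "0 = 0 *\<^sub>R s - 0 *\<^sub>R s" "s \<in> S" by auto
    then show "0 \<in> ?K" by blast
  next
    fix x y assume "x \<in> ?K" "y \<in> ?K"
    then obtain a b s t a' b' s' t' where
      x: "0 \<le> a" "0 \<le> b" "s \<in> S" "t \<in> S" "x = a *\<^sub>R s - b *\<^sub>R t" and
      y: "0 \<le> a'" "0 \<le> b'" "s' \<in> S" "t' \<in> S" "y = a' *\<^sub>R s' - b' *\<^sub>R t'"
      by blast
    obtain u where u: "u \<in> S" "a *\<^sub>R s + a' *\<^sub>R s' = (a + a') *\<^sub>R u"
      using convex_cone_combination[OF assms(1)] x y by metis
    obtain w where w: "w \<in> S" "b *\<^sub>R t + b' *\<^sub>R t' = (b + b') *\<^sub>R w"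
      using convex_cone_combination[OF assms(1)] x y by metis
    have "x + y = (a *\<^sub>R s + a' *\<^sub>R s') - (b *\<^sub>R t + b' *\<^sub>R t')"
      using x y by simp
    then have "x + y = (a + a') *\<^sub>R u - (b + b') *\<^sub>R w"
      by (simp only: u w)
    moreover have "0 \<le> a + a'" "0 \<le> b + b'" using x y by auto
    ultimately show "x + y \<in> ?K" using u(1) w(1) by blast
  next
    fix c x assume "x \<in> ?K"
    then obtain a b s t where
      x: "0 \<le> a" "0 \<le> b" "s \<in> S" "t \<in> S" "x = a *\<^sub>R s - b *\<^sub>R t"
      by blast
    show "c *\<^sub>R x \<in> ?K"
    proof (cases "c \<ge> 0")
      case True
      then have "c *\<^sub>R x = (c * a) *\<^sub>R s - (c * b) *\<^sub>R t" "0 \<le> c * a" "0 \<le> c * b"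
        using x by (auto simp: scaleR_right_diff_distrib)
      then show ?thesis using x by blast
    next
      case False
      then have "c *\<^sub>R x = (- c * b) *\<^sub>R t - (- c * a) *\<^sub>R s" "0 \<le> - c * b" "0 \<le> - c * a"
        using x by (auto simp: scaleR_right_diff_distrib mult_nonpos_nonneg)
      then show ?thesis using x by blast
    qed
  qed
  moreover have "S \<subseteq> ?K"
  proof
    fix s assume "s \<in> S"
    then have "s = 1 *\<^sub>R s - 0 *\<^sub>R s" "0 \<le> (1::real)" "0 \<le> (0::real)" by auto
    then show "s \<in> ?K" using \<open>s \<in> S\<close> by blast
  qed
  ultimately have "v \<in> ?K"
    using span_minimal assms(2) by blast
  then show ?thesis using that by blast
qed

lemma affine_function_on_convex_slope:
  fixes C :: "'a::euclidean_space set" and L :: "'a \<Rightarrow> real"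
  assumes "convex C" "z \<in> C"
    and aff: "\<And>x y t. \<lbrakk>x \<in> C; y \<in> C; 0 \<le> t; t \<le> 1\<rbrakk> \<Longrightarrow>
      L ((1 - t) *\<^sub>R x + t *\<^sub>R y) = (1 - t) * L x + t * L y"
  obtains k where "k \<in> span ((\<lambda>x. x - z) ` C)" "\<And>x. x \<in> C \<Longrightarrow> L x - L z = k \<bullet> (x - z)"
proof -
  \<comment> \<open>The graph of the centred function spans a subspace meeting the vertical axis only in 0, so
    this subspace is the graph of a linear function.\<close>
  define G where "G = (\<lambda>x. (x - z, L x - L z)) ` C"
  have "convex G"
    unfolding convex_alt
  proof (intro ballI allI impI)
    fix v w and t :: real assume "v \<in> G" "w \<in> G" and t: "0 \<le> t \<and> t \<le> 1"
    then obtain x y where xy: "x \<in> C" "y \<in> C" "v = (x - z, L x - L z)" "w = (y - z, L y - L z)"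
      by (auto simp: G_def)
    let ?u = "(1 - t) *\<^sub>R x + t *\<^sub>R y"
    have "?u \<in> C" using convexD_alt[OF assms(1)] xy t by blast
    moreover have "(1 - t) *\<^sub>R v + t *\<^sub>R w = (?u - z, L ?u - L z)"
      using aff[of x y t] xy t by (simp add: algebra_simps)
    ultimately show "(1 - t) *\<^sub>R v + t *\<^sub>R w \<in> G" by (auto simp: G_def)
  qed
  have inj: "inj_on fst (span G)"
  proof (rule linear_injective_on_subspace_0[THEN iffD2])
    show "linear (fst :: 'a \<times> real \<Rightarrow> 'a)" by (rule linear_fst)
    show "subspace (span G)" by (rule subspace_span)
    show "\<forall>v\<in>span G. fst v = 0 \<longrightarrow> v = 0"
    proof (intro ballI impI)
      fix v assume "v \<in> span G" and v0: "fst v = 0"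
      moreover have "G \<noteq> {}" using assms(2) by (auto simp: G_def)
      ultimately obtain a b s t where
        ab: "0 \<le> a" "0 \<le> b" "s \<in> G" "t \<in> G" "v = a *\<^sub>R s - b *\<^sub>R t"
        using span_convex_difference[OF \<open>convex G\<close>] by metis
      then obtain x y where xy: "x \<in> C" "y \<in> C" "s = (x - z, L x - L z)" "t = (y - z, L y - L z)"
        by (auto simp: G_def)
      \<comment> \<open>Dividing by \<open>N\<close> brings both coefficients into [0,1], so the
        scaled points lie on segments from \<open>z\<close> inside \<open>C\<close>, where
        \<open>aff\<close> applies. The summand 1 keeps \<open>N\<close> positive even if
        \<open>a\<close> and \<open>b\<close> vanish.\<close>
      define N where "N = a + b + 1"
      have N: "N > 0" "a \<le> N" "b \<le> N" using ab by (auto simp: N_def)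
      have *: "L (z + (c / N) *\<^sub>R (x - z)) - L z = (c / N) * (L x - L z)"
        if "0 \<le> c" "c \<le> N" "x \<in> C" for c x
      proof -
        have "z + (c / N) *\<^sub>R (x - z) = (1 - c / N) *\<^sub>R z + (c / N) *\<^sub>R x"
          by (simp add: algebra_simps)
        then show ?thesis
          using aff[OF assms(2) that(3), of "c / N"] that N by (simp add: algebra_simps)
      qed
      have "a *\<^sub>R (x - z) = b *\<^sub>R (y - z)"
        using v0 ab xy by simp
      then have "(1 / N) *\<^sub>R (a *\<^sub>R (x - z)) = (1 / N) *\<^sub>R (b *\<^sub>R (y - z))"
        by (rule arg_cong)
      then have "(a / N) *\<^sub>R (x - z) = (b / N) *\<^sub>R (y - z)"
        by simp
      then have "(a / N) * (L x - L z) = (b / N) * (L y - L z)"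
        using *[of a x] *[of b y] ab xy N by metis
      then have "a * (L x - L z) = b * (L y - L z)"
        using N by (simp add: field_simps)
      then show "v = 0"
        using v0 ab xy by (simp add: prod_eq_iff)
    qed
  qed
  obtain g where g: "linear g" "\<And>v. v \<in> span G \<Longrightarrow> g (fst v) = v"
    using linear_exists_left_inverse_on[OF linear_fst subspace_span inj] by blast
  define T where "T = (\<lambda>x. snd (g x))"
  have linT: "linear T"
    using linear_compose[OF g(1) linear_snd] by (simp add: T_def o_def)
  \<comment> \<open>The vector \<open>adjoint T 1\<close> represents \<open>T\<close>. Its component
    \<open>w\<close> orthogonal to the directions of \<open>C\<close> does not affect the values;
    dropping it makes the slope parallel to the affine hull, as a relative gradient must be.\<close>
  obtain k w where k: "k \<in> span ((\<lambda>x. x - z) ` C)"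
    and w: "\<And>v. v \<in> span ((\<lambda>x. x - z) ` C) \<Longrightarrow> orthogonal w v"
    and kw: "adjoint T 1 = k + w"
    using orthogonal_subspace_decomp_exists[of "(\<lambda>x. x - z) ` C" "adjoint T 1"] by blast
  have "L x - L z = k \<bullet> (x - z)" if "x \<in> C" for x
  proof -
    have "(x - z, L x - L z) \<in> span G"
      using that by (auto simp: G_def intro: span_base)
    from g(2)[OF this] have "T (x - z) = L x - L z" by (simp add: T_def)
    moreover have "T (x - z) = (x - z) \<bullet> adjoint T 1"
      using adjoint_works[OF linT, of "x - z" 1] by simp
    moreover have "w \<bullet> (x - z) = 0"
      using w[of "x - z"] that by (auto simp: orthogonal_def intro: span_base)
    ultimately show ?thesis
      by (simp add: kw inner_add_right inner_commute)
  qed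
  with k show ?thesis by (rule that)
qed

text \<open>By linearity, continuity of the inner products passes from \<open>S\<close> to an
  orthonormal basis of its span, and \<open>f p\<close> is the expansion with these inner products
  as coefficients.\<close>

lemma continuous_on_of_inner_span:
  fixes f :: "'b::topological_space \<Rightarrow> 'a::euclidean_space"
  assumes "\<And>p. p \<in> A \<Longrightarrow> f p \<in> span S"
    and "\<And>s. s \<in> S \<Longrightarrow> continuous_on A (\<lambda>p. f p \<bullet> s)"
  shows "continuous_on A f"
proof -
  obtain B where B: "B \<subseteq> span S" "pairwise orthogonal B" "\<And>x. x \<in> B \<Longrightarrow> norm x = 1"
    "independent B" "span B = span S"
    using orthonormal_basis_subspace[OF subspace_span[of S]] by metis
  have fin: "finite B" using B(4) by (rule finiteI_independent)
  have cont: "continuous_on A (\<lambda>p. f p \<bullet> v)" if "v \<in> span S" for v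
    using that
  proof (induction rule: span_induct_alt)
    case base
    then show ?case by simp
  next
    case (step c x y)
    then show ?case
      using assms(2) by (simp add: inner_add_right continuous_on_add continuous_on_mult_left)
  qed
  have "continuous_on A (\<lambda>p. \<Sum>b\<in>B. (f p \<bullet> b) *\<^sub>R b)"
    using B(1) by (intro continuous_on_sum continuous_on_scaleR cont continuous_on_const) auto
  moreover have "(\<Sum>b\<in>B. (f p \<bullet> b) *\<^sub>R b) = f p" if "p \<in> A" for p
    using orthonormal_basis_expand[OF B(2,3) _ fin] assms(1)[OF that] B(5) by simp
  ultimately show ?thesis by (simp cong: continuous_on_cong)
qed

section \<open>Stationarity in the relative interior\<close>

lemma has_derivative_0_rel_interior_min:
  fixes f :: "'a::euclidean_space \<Rightarrow> real"
  assumes "convex C" "p \<in> rel_interior C" "f differentiable (at p within C)"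
    and min: "\<And>x. x \<in> C \<Longrightarrow> f p \<le> f x"
  shows "(f has_derivative (\<lambda>h. 0)) (at p within C)"
proof -
  obtain D where D: "(f has_derivative D) (at p within C)"
    using assms(3) by (auto simp: differentiable_def)
  have pC: "p \<in> C" using assms(2) rel_interior_subset by blast
  have "D (y - p) = 0" if y: "y \<in> C" for y
  proof -
    \<comment> \<open>A relative interior point lets the segment from \<open>y\<close> be prolonged
      beyond \<open>p\<close> within \<open>C\<close>. Along this line \<open>p\<close> is a
      two-sided local minimum, so the derivative in the direction \<open>y - p\<close> is 0.\<close>
    obtain e where e: "e > 1" "(1 - e) *\<^sub>R y + e *\<^sub>R p \<in> C"
      using convex_rel_interior_iff[OF assms(1)] assms(2) y by blast
    define d where "d = min 1 (e - 1)"
    have d: "0 < d" "d \<le> 1" "d \<le> e - 1" using e by (auto simp: d_def)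
    let ?s = "\<lambda>t::real. p + t *\<^sub>R (y - p)"
    have inC: "?s t \<in> C" if t: "\<bar>t\<bar> < d" for t
    proof (cases "t \<ge> 0")
      case True
      have "?s t = (1 - t) *\<^sub>R p + t *\<^sub>R y" by (simp add: algebra_simps)
      then show ?thesis
        using convexD_alt[OF assms(1) pC y, of t] True t d by simp
    next
      case False
      \<comment> \<open>The prolonged endpoint is \<open>p - (e - 1) *\<^sub>R (y - p)\<close>;
        \<open>c\<close> is the fraction of the way from \<open>p\<close> to it. The bound
        \<open>d \<le> e - 1\<close> gives \<open>c \<le> 1\<close>.\<close>
      define c where "c = - t / (e - 1)"
      have c: "0 \<le> c" "c \<le> 1" "c * (e - 1) = - t"
        using False t d e by (auto simp: c_def field_simps)
      have "?s t = p - (- t) *\<^sub>R (y - p)" by simp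
      also have "\<dots> = (1 - c) *\<^sub>R p + c *\<^sub>R ((1 - e) *\<^sub>R y + e *\<^sub>R p)"
        unfolding c(3)[symmetric] by (simp add: algebra_simps)
      finally show ?thesis
        using convexD_alt[OF assms(1) pC e(2), of c] c by simp
    qed
    have "(?s has_derivative (\<lambda>t. t *\<^sub>R (y - p))) (at 0 within {-d<..<d})"
      by (auto intro!: derivative_eq_intros)
    moreover have "(f has_derivative D) (at (?s 0) within ?s ` {-d<..<d})"
      using inC by (auto intro!: has_derivative_subset[OF D])
    ultimately have "((\<lambda>t. f (?s t)) has_derivative (\<lambda>t. D (t *\<^sub>R (y - p)))) (at 0 within {-d<..<d})"
      by (rule has_derivative_in_compose)
    then have "((\<lambda>t. f (?s t)) has_derivative (\<lambda>t. D (t *\<^sub>R (y - p)))) (at 0)"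
      using d by (simp add: at_within_open[of 0 "{-d<..<d}"])
    then have "((\<lambda>t. f (?s t)) has_real_derivative D (y - p)) (at 0)"
      using linear_cmul[OF has_derivative_linear[OF D]]
      by (simp add: has_field_derivative_def mult_commute_abs)
    then show ?thesis
      using inC min d by (elim DERIV_local_min[of _ _ _ d]) auto
  qed
  \<comment> \<open>A derivative within \<open>C\<close> is tested only on increments
    \<open>y - p\<close> with \<open>y\<close> in \<open>C\<close>, so 0 may replace
    \<open>D\<close> even if \<open>D\<close> is nonzero transversally to the affine hull.\<close>
  then show ?thesis
    using D by (simp add: has_derivative_within_alt)
qed

text \<open>The relative interior is convex, so \<open>f\<close> is constant there. It is also dense
  in \<open>C\<close>, and a level set of \<open>f\<close> is closed in \<open>C\<close>, which
  carries the constant to the relative boundary.\<close>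

lemma constant_on_convex_if_rel_interior_derivative_0:
  fixes f :: "'a::euclidean_space \<Rightarrow> real"
  assumes "convex C" "continuous_on C f"
    and der: "\<And>p. p \<in> rel_interior C \<Longrightarrow> (f has_derivative (\<lambda>h. 0)) (at p within C)"
    and "x \<in> C" "y \<in> C"
  shows "f x = f y"
proof -
  let ?R = "rel_interior C"
  have "\<exists>c. \<forall>p\<in>?R. f p = c"
    by (rule has_derivative_zero_constant[OF convex_rel_interior[OF assms(1)]])
      (rule has_derivative_subset[OF der rel_interior_subset])
  then obtain c where c: "\<And>p. p \<in> ?R \<Longrightarrow> f p = c" by blast
  obtain T where T: "closed T" "{p \<in> C. f p = c} = C \<inter> T"
    using continuous_closedin_preimage_constant[OF assms(2), of c] 
    unfolding closedin_closed by blast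
  have "?R \<subseteq> {p \<in> C. f p = c}" using c rel_interior_subset by blast
  then have "?R \<subseteq> T" unfolding T(2) by simp
  then have "closure ?R \<subseteq> T" using T(1) by (rule closure_minimal)
  then have "C \<subseteq> T"
    using convex_closure_rel_interior[OF assms(1)] closure_subset[of C] by simp
  then have "C \<subseteq> {p \<in> C. f p = c}" unfolding T(2) by simp
  then have "f x = c" "f y = c" using assms(4,5) by auto
  then show ?thesis by simp
qed

section \<open>From expectation optimality to affine loss differences\<close>

lemma expectation_three_points:
  fixes h :: "'a \<Rightarrow> 'b::euclidean_space"
  assumes "0 \<le> s" "s \<le> 1" "0 \<le> t" "t \<le> 1"
  shows "measure_pmf.expectation (map_pmf (\<lambda>(b,c). if b then w else if c then y else x)
           (pair_pmf (bernoulli_pmf t) (bernoulli_pmf s))) h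
    = t *\<^sub>R h w + (1 - t) *\<^sub>R ((1 - s) *\<^sub>R h x + s *\<^sub>R h y)"
proof -
  have U: "(UNIV :: (bool \<times> bool) set) = {(True,True),(True,False),(False,True),(False,False)}"
    by auto
  have "measure_pmf.expectation (map_pmf (\<lambda>(b,c). if b then w else if c then y else x)
           (pair_pmf (bernoulli_pmf t) (bernoulli_pmf s))) h
    = (\<Sum>a\<in>UNIV. pmf (pair_pmf (bernoulli_pmf t) (bernoulli_pmf s)) a *\<^sub>R
        h (case a of (b,c) \<Rightarrow> if b then w else if c then y else x))"
    by (simp add: integral_measure_pmf[where A = UNIV] del: UNIV_Times_UNIV)
  also have "\<dots> = t *\<^sub>R h w + (1 - t) *\<^sub>R ((1 - s) *\<^sub>R h x + s *\<^sub>R h y)"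
    using assms by (simp add: U pmf_pair algebra_simps)
  finally show ?thesis .
qed

text \<open>Two independent coins realise the distribution: the first selects \<open>w\<close>,
  otherwise the second chooses between \<open>y\<close> and \<open>x\<close>. Taking
  \<open>x = y\<close> covers distributions on two points.\<close>

lemma three_point_optimality:
  fixes C :: "'a::euclidean_space set" and loss :: "'a \<Rightarrow> 'a \<Rightarrow> real"
  assumes opt: "\<And>Q :: 'a pmf. finite (set_pmf Q) \<Longrightarrow> set_pmf Q \<subseteq> C \<Longrightarrow>
      is_arg_min (\<lambda>p. measure_pmf.expectation Q (\<lambda>\<omega>. loss \<omega> p)) (\<lambda>p. p \<in> C)
        (measure_pmf.expectation Q (\<lambda>\<omega>. \<omega>))"
    and "x \<in> C" "y \<in> C" "w \<in> C" "0 \<le> s" "s \<le> 1" "0 \<le> t" "t \<le> 1"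
    and p: "p = t *\<^sub>R w + (1 - t) *\<^sub>R ((1 - s) *\<^sub>R x + s *\<^sub>R y)" and "u \<in> C"
  shows "t * loss w p + (1 - t) * ((1 - s) * loss x p + s * loss y p)
    \<le> t * loss w u + (1 - t) * ((1 - s) * loss x u + s * loss y u)"
proof -
  let ?Q = "map_pmf (\<lambda>(b,c). if b then w else if c then y else x)
           (pair_pmf (bernoulli_pmf t) (bernoulli_pmf s))"
  have fin: "finite (set_pmf ?Q)"
    by (simp only: set_map_pmf) (rule finite_imageI, rule finite)
  have sub: "set_pmf ?Q \<subseteq> C" using assms by auto
  show ?thesis
    using opt[OF fin sub] \<open>u \<in> C\<close> assms(5-8)
    by (simp only: expectation_three_points is_arg_min_linorder p) (simp add: p)
qed

lemma loss_difference_affine: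
  fixes C :: "'a::euclidean_space set" and loss :: "'a \<Rightarrow> 'a \<Rightarrow> real"
  assumes "convex C"
    and diff: "\<And>q. q \<in> C \<Longrightarrow> loss q differentiable_on C"
    and opt: "\<And>Q :: 'a pmf. finite (set_pmf Q) \<Longrightarrow> set_pmf Q \<subseteq> C \<Longrightarrow>
      is_arg_min (\<lambda>p. measure_pmf.expectation Q (\<lambda>\<omega>. loss \<omega> p)) (\<lambda>p. p \<in> C)
        (measure_pmf.expectation Q (\<lambda>\<omega>. \<omega>))"
    and "x \<in> C" "y \<in> C" "0 \<le> s" "s \<le> 1" "u \<in> C" "v \<in> C"
  defines "q \<equiv> (1 - s) *\<^sub>R x + s *\<^sub>R y"
  shows "loss q u - loss q v = (1 - s) * (loss x u - loss x v) + s * (loss y u - loss y v)"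
proof -
  have qC: "q \<in> C" unfolding q_def by (rule convexD_alt) (use assms in auto)
  define f where "f = (\<lambda>p. loss q p - ((1 - s) * loss x p + s * loss y p))"
  have "f u = f v"
  proof (rule constant_on_convex_if_rel_interior_derivative_0[of C])
    show "continuous_on C f"
      unfolding f_def using diff assms qC
      by (intro continuous_intros differentiable_imp_continuous_on) auto
    fix p assume p: "p \<in> rel_interior C"
    then have pC: "p \<in> C" using rel_interior_subset by blast
    \<comment> \<open>Going from \<open>q\<close> through \<open>p\<close> and beyond gives
      \<open>w\<close> in \<open>C\<close>, and the weight \<open>t = 1 / e\<close> makes
      \<open>p\<close> the mean of \<open>w\<close> and \<open>q\<close>. Here \<open>t < 1\<close>,
      so \<open>1 - t\<close> can be divided out below.\<close>
    obtain e where e: "e > 1" "(1 - e) *\<^sub>R q + e *\<^sub>R p \<in> C"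
      using convex_rel_interior_iff[OF assms(1)] p qC by blast
    define w where "w = (1 - e) *\<^sub>R q + e *\<^sub>R p"
    define t where "t = 1 / e"
    have wC: "w \<in> C" using e by (simp add: w_def)
    have t: "0 \<le> t" "t \<le> 1" "1 - t > 0" "t * e = 1" using e by (auto simp: t_def)
    have "t *\<^sub>R w + (1 - t) *\<^sub>R q = (t * e) *\<^sub>R p + (1 - t * e) *\<^sub>R q"
      by (simp add: w_def algebra_simps)
    then have pq: "p = t *\<^sub>R w + (1 - t) *\<^sub>R q" using t by simp
    have d: "loss r differentiable at p within C" if "r \<in> C" for r
      using diff[OF that] pC by (auto simp: differentiable_on_def)
    \<comment> \<open>In \<open>?g\<close> the loss of \<open>q\<close> is split as a trivial
      mixture, so that \<open>?g\<close> and \<open>?h\<close> are both instances of the three-point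
      expectation. Splitting \<open>q\<close> into \<open>x\<close> and \<open>y\<close> keeps the
      mean, so both are minimal at \<open>p\<close>.\<close>
    let ?g = "\<lambda>p. t * loss w p + (1 - t) * ((1 - s) * loss q p + s * loss q p)"
    let ?h = "\<lambda>p. t * loss w p + (1 - t) * ((1 - s) * loss x p + s * loss y p)"
    have g: "(?g has_derivative (\<lambda>_. 0)) (at p within C)"
    proof (rule has_derivative_0_rel_interior_min[OF assms(1) p])
      show "?g differentiable at p within C"
        using d qC wC by (intro differentiable_add differentiable_mult differentiable_const) auto
      have "p = t *\<^sub>R w + (1 - t) *\<^sub>R ((1 - s) *\<^sub>R q + s *\<^sub>R q)"
        by (subst pq) (simp add: algebra_simps)
      then show "?g p \<le> ?g r" if "r \<in> C" for r
        using three_point_optimality[OF opt qC qC wC assms(6,7) t(1,2) _ that] by blast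
    qed
    have h: "(?h has_derivative (\<lambda>_. 0)) (at p within C)"
    proof (rule has_derivative_0_rel_interior_min[OF assms(1) p])
      show "?h differentiable at p within C"
        using d assms wC by (intro differentiable_add differentiable_mult differentiable_const) auto
      show "?h p \<le> ?h r" if "r \<in> C" for r
        using three_point_optimality[OF opt assms(4,5) wC assms(6,7) t(1,2) _ that] pq
        unfolding q_def by blast
    qed
    \<comment> \<open>The terms with \<open>loss w\<close> cancel in the difference, and the factor
      normalises what remains to \<open>f\<close>.\<close>
    have "((\<lambda>p. (1 / (1 - t)) * (?g p - ?h p)) has_derivative (\<lambda>_. (1 / (1 - t)) * (0 - 0))) (at p within C)"
      by (intro has_derivative_mult_right has_derivative_diff g h)
    moreover have "(\<lambda>p. (1 / (1 - t)) * (?g p - ?h p)) = f"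
      using t(3) by (auto simp: f_def fun_eq_iff field_simps)
    ultimately show "(f has_derivative (\<lambda>h. 0)) (at p within C)" by simp
  qed (use assms in auto)
  then show ?thesis by (simp add: f_def algebra_simps)
qed

section \<open>Strict minimality, subgradients and conjugates\<close>

lemma H_convex_on_unique_min:
  assumes "l2_norm_power_function \<psi>" "H_convex_on C \<psi> f" "convex C"
    and "x \<in> C" "y \<in> C" "x \<noteq> y" and min: "\<And>u. u \<in> C \<Longrightarrow> f x \<le> f u"
  shows "f x < f y"
proof (rule ccontr)
  assume "\<not> f x < f y"
  then have eq: "f y = f x" using min[OF assms(5)] by simp
  \<comment> \<open>At the midpoint the linear terms of the two remainders are opposite. Adding the
    strict inequalities gives \<open>f x + f y > 2 * f m\<close>, which contradicts minimality when
    \<open>f y = f x\<close>.\<close>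
  define m where "m = y + (1/2) *\<^sub>R (x - y)"
  have conv: "y + t *\<^sub>R (x - y) = (1 - t) *\<^sub>R y + t *\<^sub>R x"
    and diff: "x - (y + t *\<^sub>R (x - y)) = (1 - t) *\<^sub>R (x - y)" for t :: real
    by (simp_all add: algebra_simps)
  have m: "m \<in> C"
    unfolding m_def conv by (rule convexD_alt) (use assms in auto)
  have xm: "x - m = (1/2) *\<^sub>R (x - y)" unfolding m_def diff by simp
  have ym: "y - m = - (x - m)" unfolding xm by (simp add: m_def)
  have ne: "x - m \<noteq> 0" using assms(6) by (simp add: xm)
  have pos: "\<psi> v > 0" if "v \<noteq> 0" for v
    using assms(1) that by (auto simp: l2_norm_power_function_def)
  have "bregman_remainder C f x m \<ge> \<psi> (x - m)" "bregman_remainder C f y m \<ge> \<psi> (y - m)"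
    using assms(2,4,5) m by (auto simp: H_convex_on_def)
  moreover have "\<psi> (x - m) > 0" "\<psi> (y - m) > 0" using ne ym pos by auto
  ultimately have "f x - f m - rel_gradient C f m \<bullet> (x - m) > 0"
    "f y - f m - rel_gradient C f m \<bullet> (y - m) > 0"
    unfolding bregman_remainder_def by linarith+
  moreover have "rel_gradient C f m \<bullet> (y - m) = - (rel_gradient C f m \<bullet> (x - m))"
    by (simp only: ym inner_minus_right)
  ultimately show False using min[OF m] eq by linarith
qed

lemma rel_gradient_eqI:
  assumes "convex C" "p \<in> C" "has_rel_gradient C f p g"
  shows "rel_gradient C f p = g"
  unfolding rel_gradient_def using assms has_rel_gradient_unique[OF assms(1,2)] by blast

text \<open>With \<open>p\<close> the convex combination of \<open>x\<close> and \<open>y\<close>,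
  the linear terms at \<open>p\<close> cancel when the inequalities for \<open>x\<close> and
  \<open>y\<close> are weighted by \<open>1 - t\<close> and \<open>t\<close>. Both are strict
  because \<open>p\<close> differs from both endpoints.\<close>

lemma strictly_convex_on_if_strict_subgradient:
  fixes \<eta> :: "'a::euclidean_space \<Rightarrow> 'a"
  assumes "convex C"
    and "\<And>x p. \<lbrakk>x \<in> C; p \<in> C; x \<noteq> p\<rbrakk> \<Longrightarrow> f p + \<eta> p \<bullet> (x - p) < f x"
  shows "strictly_convex_on C f"
  unfolding strictly_convex_on_def
proof (intro conjI ballI allI impI)
  fix x y and t :: real assume xy: "x \<in> C" "y \<in> C" and t: "x \<noteq> y \<and> 0 < t \<and> t < 1"
  define p where "p = (1 - t) *\<^sub>R x + t *\<^sub>R y"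
  have pC: "p \<in> C" unfolding p_def using convexD_alt[OF assms(1) xy] t by simp
  have xp: "x - p = t *\<^sub>R (x - y)" and yp: "y - p = (t - 1) *\<^sub>R (x - y)"
    by (simp_all add: p_def algebra_simps)
  have "x - p \<noteq> 0" "y - p \<noteq> 0" unfolding xp yp using t by auto
  then have *: "f p + \<eta> p \<bullet> (x - p) < f x" "f p + \<eta> p \<bullet> (y - p) < f y"
    using assms(2) xy pC by auto
  have "(1 - t) * (f p + \<eta> p \<bullet> (x - p)) + t * (f p + \<eta> p \<bullet> (y - p)) < (1 - t) * f x + t * f y"
    using * t by (intro add_strict_mono mult_strict_left_mono) auto
  moreover have "(1 - t) * (f p + \<eta> p \<bullet> (x - p)) + t * (f p + \<eta> p \<bullet> (y - p)) = f p"
    unfolding xp yp by (simp add: algebra_simps)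
  ultimately show "f ((1 - t) *\<^sub>R x + t *\<^sub>R y) < (1 - t) * f x + t * f y"
    by (simp add: p_def)
qed (rule assms(1))

lemma has_derivative_if_monotone_remainder:
  fixes f :: "'a::euclidean_space \<Rightarrow> real"
  assumes "continuous_on C \<eta>" "p \<in> C"
    and "\<And>q. q \<in> C \<Longrightarrow> 0 \<le> f q - f p - \<eta> p \<bullet> (q - p)"
    and "\<And>q. q \<in> C \<Longrightarrow> f q - f p - \<eta> p \<bullet> (q - p) \<le> (\<eta> q - \<eta> p) \<bullet> (q - p)"
  shows "(f has_derivative (\<lambda>h. \<eta> p \<bullet> h)) (at p within C)"
  unfolding has_derivative_within_alt
proof (intro conjI allI impI)
  show "bounded_linear (\<lambda>h. \<eta> p \<bullet> h)" by (rule bounded_linear_inner_right)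
  fix e :: real assume "e > 0"
  then obtain d where d: "d > 0" "\<And>q. \<lbrakk>q \<in> C; dist q p < d\<rbrakk> \<Longrightarrow> dist (\<eta> q) (\<eta> p) < e"
    using assms(1,2) unfolding continuous_on_iff by metis
  have "norm (f q - f p - \<eta> p \<bullet> (q - p)) \<le> e * norm (q - p)"
    if "q \<in> C" "norm (q - p) < d" for q
  proof -
    have "norm (f q - f p - \<eta> p \<bullet> (q - p)) \<le> (\<eta> q - \<eta> p) \<bullet> (q - p)"
      using assms(3,4)[OF that(1)] by simp
    also have "\<dots> \<le> norm (\<eta> q - \<eta> p) * norm (q - p)"
      by (rule norm_cauchy_schwarz)
    also have "\<dots> \<le> e * norm (q - p)"
      using d(2)[of q] that by (intro mult_right_mono) (auto simp: dist_norm)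
    finally show ?thesis .
  qed
  then show "\<exists>d>0. \<forall>q\<in>C. norm (q - p) < d \<longrightarrow>
      norm (f q - f p - \<eta> p \<bullet> (q - p)) \<le> e * norm (q - p)"
    using d(1) by blast
qed

text \<open>The subgradient inequality says exactly that the supremum defining the conjugate at
  \<open>g\<close> is attained at \<open>p\<close>; hence the conjugate is finite there.\<close>

lemma fenchel_young_loss_subgradient:
  fixes g :: "'a::euclidean_space"
  assumes "p \<in> C" "\<And>x. x \<in> C \<Longrightarrow> \<Phi> p + g \<bullet> (x - p) \<le> \<Phi> x"
  shows "fenchel_young_loss C \<Phi> q g = ereal (\<Phi> q - \<Phi> p - g \<bullet> (q - p))"
proof -
  have "conjugate C \<Phi> g = ereal (p \<bullet> g - \<Phi> p)"
    unfolding conjugate_def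
  proof (rule antisym)
    show "(SUP \<mu>\<in>C. ereal (\<mu> \<bullet> g - \<Phi> \<mu>)) \<le> ereal (p \<bullet> g - \<Phi> p)"
    proof (rule SUP_least)
      fix x assume "x \<in> C"
      from assms(2)[OF this] show "ereal (x \<bullet> g - \<Phi> x) \<le> ereal (p \<bullet> g - \<Phi> p)"
        by (simp add: inner_diff_right inner_commute)
    qed
    show "ereal (p \<bullet> g - \<Phi> p) \<le> (SUP \<mu>\<in>C. ereal (\<mu> \<bullet> g - \<Phi> \<mu>))"
      using assms(1) by (rule SUP_upper)
  qed
  then show ?thesis
    by (simp add: fenchel_young_loss_def inner_diff_right inner_commute)
qed

section \<open>The potential built from the slopes\<close>

theorem proposition1:
  fixes C :: "(real ^ 'm) set"
    and loss :: "real ^ 'm \<Rightarrow> real ^ 'm \<Rightarrow> real"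
    and \<psi> :: "real ^ 'm \<Rightarrow> real"
  assumes "C \<noteq> {}"
    and "convex C"
    and differentiable: "\<And>q. q \<in> C \<Longrightarrow> loss q differentiable_on C"
    and "l2_norm_power_function \<psi>"
    and extended_convexity: "\<And>q. q \<in> C \<Longrightarrow> H_convex_on C \<psi> (loss q)"
    and expectation_optimality:
      "\<And>Q :: (real ^ 'm) pmf. finite (set_pmf Q) \<Longrightarrow> set_pmf Q \<subseteq> C \<Longrightarrow>
         is_arg_min (\<lambda>p. measure_pmf.expectation Q (\<lambda>\<omega>. loss \<omega> p)) (\<lambda>p. p \<in> C)
           (measure_pmf.expectation Q (\<lambda>\<omega>. \<omega>))"
  shows "\<exists>\<Phi>. strictly_convex_on C \<Phi> \<and> \<Phi> differentiable_on C \<and>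
           (\<forall>q\<in>C. \<forall>p\<in>C.
              ereal (loss q p - loss q q) = fenchel_young_loss C \<Phi> q (rel_gradient C \<Phi> p))"
proof -
  obtain z where z: "z \<in> C" using \<open>C \<noteq> {}\<close> by blast
  let ?V = "(\<lambda>x. x - z) ` C"
  have "\<exists>k. k \<in> span ?V \<and> (\<forall>q\<in>C. (loss q z - loss q p) - (loss z z - loss z p) = k \<bullet> (q - z))"
    if p: "p \<in> C" for p
  proof (rule affine_function_on_convex_slope[OF \<open>convex C\<close> z, of "\<lambda>q. loss q z - loss q p"])
    show "loss ((1 - t) *\<^sub>R x + t *\<^sub>R y) z - loss ((1 - t) *\<^sub>R x + t *\<^sub>R y) p =
        (1 - t) * (loss x z - loss x p) + t * (loss y z - loss y p)"
      if "x \<in> C" "y \<in> C" "0 \<le> t" "t \<le> 1" for x y t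
      using loss_difference_affine[OF \<open>convex C\<close> differentiable expectation_optimality that z p]
      by blast
  qed blast
  then obtain \<eta> where \<eta>: "\<And>p. p \<in> C \<Longrightarrow> \<eta> p \<in> span ?V"
    and slope: "\<And>p q. \<lbrakk>p \<in> C; q \<in> C\<rbrakk> \<Longrightarrow>
      (loss q z - loss q p) - (loss z z - loss z p) = \<eta> p \<bullet> (q - z)"
    by metis
  have "continuous_on C \<eta>"
  \<comment> \<open>Tested against a spanning vector \<open>q - z\<close>, the slope is a
    combination of losses at \<open>p\<close>, and these are continuous in \<open>p\<close>.\<close>
  proof (rule continuous_on_of_inner_span[OF \<eta>])
    fix s assume "s \<in> ?V"
    then obtain q where q: "q \<in> C" "s = q - z" by blast
    have "continuous_on C (\<lambda>p. (loss q z - loss q p) - (loss z z - loss z p))"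
      using differentiable q z by (intro continuous_intros differentiable_imp_continuous_on)
    then show "continuous_on C (\<lambda>p. \<eta> p \<bullet> s)"
      using slope q by (simp cong: continuous_on_cong)
  qed
  \<comment> \<open>Since \<open>loss q z\<close> itself need not be affine in \<open>q\<close>, the
    diagonal is subtracted from it: only the differences \<open>loss q z - loss q p\<close>, whose
    slope is \<open>\<eta> p\<close>, then enter the remainder.\<close>
  define \<Phi> where "\<Phi> = (\<lambda>q. loss q z - loss q q)"
  have rem: "\<Phi> q - \<Phi> p - \<eta> p \<bullet> (q - p) = loss q p - loss q q" if "p \<in> C" "q \<in> C" for p q
  proof -
    have "\<eta> p \<bullet> (q - p) = \<eta> p \<bullet> (q - z) - \<eta> p \<bullet> (p - z)" by (simp add: inner_diff_right)
    then show ?thesis using slope[of p q] slope[of p p] that by (simp add: \<Phi>_def)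
  qed
  have opt: "loss q q \<le> loss q p" if "p \<in> C" "q \<in> C" for p q
    using expectation_optimality[of "return_pmf q"] that by (simp add: is_arg_min_linorder)
  have der: "(\<Phi> has_derivative (\<lambda>h. \<eta> p \<bullet> h)) (at p within C)" if p: "p \<in> C" for p
  proof (rule has_derivative_if_monotone_remainder[OF \<open>continuous_on C \<eta>\<close> p])
    fix q assume q: "q \<in> C"
    show "0 \<le> \<Phi> q - \<Phi> p - \<eta> p \<bullet> (q - p)" using rem opt p q by simp
    \<comment> \<open>The remainder with \<open>p\<close> and \<open>q\<close> exchanged is
      nonnegative too, and the two remainders add up to the bound required here.\<close>
    have "0 \<le> \<Phi> p - \<Phi> q - \<eta> q \<bullet> (p - q)" using rem opt p q by simp
    then show "\<Phi> q - \<Phi> p - \<eta> p \<bullet> (q - p) \<le> (\<eta> q - \<eta> p) \<bullet> (q - p)"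
      by (simp add: inner_diff_left inner_diff_right)
  qed
  have grad: "rel_gradient C \<Phi> p = \<eta> p" if p: "p \<in> C" for p
  proof (rule rel_gradient_eqI[OF \<open>convex C\<close> p])
    have zh: "z \<in> affine hull C" using z by (rule hull_inc)
    have "z + \<eta> p \<in> affine hull C"
      using affine_hull_span_gen[OF zh] \<eta>[OF p] by simp
    then have "\<eta> p \<in> {u - v |u v. u \<in> affine hull C \<and> v \<in> affine hull C}"
      using zh by (metis (mono_tags, lifting) add_diff_cancel_left' mem_Collect_eq)
    then show "has_rel_gradient C \<Phi> p (\<eta> p)"
      using der[OF p] by (simp add: has_rel_gradient_def)
  qed
  have "strictly_convex_on C \<Phi>"
  proof (rule strictly_convex_on_if_strict_subgradient[OF \<open>convex C\<close>])
    fix x p assume xp: "x \<in> C" "p \<in> C" "x \<noteq> p"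
    \<comment> \<open>Extended convexity enters here: it turns optimality at the point mass on
      \<open>x\<close> into strict optimality.\<close>
    have "loss x x < loss x p"
      by (rule H_convex_on_unique_min[OF \<open>l2_norm_power_function \<psi>\<close> extended_convexity \<open>convex C\<close>])
        (use xp opt in auto)
    then show "\<Phi> p + \<eta> p \<bullet> (x - p) < \<Phi> x" using rem[of p x] xp by linarith
  qed
  moreover have "\<Phi> differentiable_on C"
    using der by (auto simp: differentiable_on_def differentiable_def)
  moreover have "ereal (loss q p - loss q q) = fenchel_young_loss C \<Phi> q (rel_gradient C \<Phi> p)"
    if "q \<in> C" "p \<in> C" for q p
  proof -
    have "\<Phi> p + \<eta> p \<bullet> (x - p) \<le> \<Phi> x" if "x \<in> C" for x
      using rem[of p x] opt[of p x] that \<open>p \<in> C\<close> by linarith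
    then show ?thesis
      using fenchel_young_loss_subgradient[of p C \<Phi> "\<eta> p" q] that grad rem by simp
  qed
  ultimately show ?thesis by blast
qed

end
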